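(* Let $\mathbb{X}$ be an $n$-dimensional Banach space and let $\mathbb{Y}$ be any strictly convex Banach space, both over the same field $\mathbb{K}\in\{\mathbb{R},\mathbb{C}\}$. Let $T\in\mathbb{L}(\mathbb{X},\mathbb{Y})$ be such that $\|T\|=1$ and $T$ attains norm at $n$ linearly independent unit vectors $x_1,x_2,\ldots,x_n\in\mathbb{X}$. Then $T$ is an extreme contraction in $\mathbb{L}(\mathbb{X},\mathbb{Y})$.
   Context: $\mathbb{L}(\mathbb{X},\mathbb{Y})$ denotes the space of bounded linear operators from $\mathbb{X}$ to $\mathbb{Y}$, with the operator norm. $T$ attains norm at a unit vector $x$ if $\|Tx\|=\|T\|$. $T\in\mathbb{L}(\mathbb{X},\mathbb{Y})$ is a contraction if $\|T\|\le 1$, and is an extreme contraction if in addition it is an extreme point of the closed unit ball of $\mathbb{L}(\mathbb{X},\mathbb{Y})$. A Banach space $\mathbb{Y}$ is strictly convex if for all $x,y\in\mathbb{Y}$, with $x\neq 0$, $\|x+y\|=\|x\|+\|y\|$ implies $y=kx$ for some $k\ge 0$; equivalently, every point of its unit sphere is an extreme point of its closed unit ball. *)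

theory Defs
  imports "HOL-Analysis.Analysis"
begin

text \<open>
  The scalar fields are \<open>\<real>\<close> and \<open>\<complex>\<close>. The axiom leaves exactly these two, up to an isomorphism of
  real algebras; it is automatically isometric, because the norm of a \<^class>\<open>real_normed_field\<close>
  is multiplicative.
\<close>

class real_or_complex = real_normed_field +
  assumes real_or_complex:
    "(\<forall>z. \<exists>a. z = a *\<^sub>R 1) \<or> (\<exists>i. i * i = - 1 \<and> (\<forall>z. \<exists>a b. z = a *\<^sub>R 1 + b *\<^sub>R i))"

instance real :: real_or_complex
  by standard simp

instance complex :: real_or_complex
proof
  have "z = Re z *\<^sub>R 1 + Im z *\<^sub>R imaginary_unit" for z
    by (simp add: complex_eq_iff)
  then show "(\<forall>z::complex. \<exists>a. z = a *\<^sub>R 1) \<or>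
      (\<exists>i::complex. i * i = - 1 \<and> (\<forall>z. \<exists>a b. z = a *\<^sub>R 1 + b *\<^sub>R i))"
    using i_squared by blast
qed

text \<open>
  A normed space over \<open>'k\<close> is given by its underlying real normed space (a type) together with
  a multiplication by scalars from \<open>'k\<close> that extends the multiplication by real scalars.
  Completeness does not depend on the scalars and is expressed by \<^class>\<open>banach\<close>.
\<close>

locale normed_space_over = vector_space scale
  for scale :: "'k::real_or_complex \<Rightarrow> 'a::real_normed_vector \<Rightarrow> 'a" +
  assumes scale_of_real: "scale (of_real r) x = r *\<^sub>R x"
    and norm_scale: "norm (scale c x) = norm c * norm x"

lemma normed_space_over_real:
  fixes scale :: "real \<Rightarrow> 'a::real_normed_vector \<Rightarrow> 'a"
  shows "normed_space_over scale \<longleftrightarrow> scale = scaleR"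
proof
  assume "normed_space_over scale"
  then interpret normed_space_over scale .
  show "scale = scaleR"
    using scale_of_real by (intro ext) simp
next
  assume "scale = scaleR"
  then show "normed_space_over scale"
    by unfold_locales (simp_all add: algebra_simps)
qed

lemma normed_space_over_complex: "normed_space_over ((*) :: complex \<Rightarrow> complex \<Rightarrow> complex)"
  by unfold_locales (simp_all add: algebra_simps norm_mult scaleR_conv_of_real)

text \<open>
  The space \<open>\<L>(X,Y)\<close>: the type \<open>'x \<Rightarrow>\<^sub>L 'y\<close> consists of the bounded real-linear operators with the
  operator norm, and the \<open>'k\<close>-linear ones are singled out here.
\<close>

definition bounded_operators ::
    "('k::real_or_complex \<Rightarrow> 'x::real_normed_vector \<Rightarrow> 'x) \<Rightarrow> ('k \<Rightarrow> 'y::real_normed_vector \<Rightarrow> 'y) \<Rightarrow>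
      ('x \<Rightarrow>\<^sub>L 'y) set"
  where "bounded_operators sX sY = {T. Vector_Spaces.linear sX sY (blinfun_apply T)}"

lemma bounded_operators_real: "bounded_operators scaleR scaleR = UNIV"
  using bounded_linear.linear[OF blinfun.bounded_linear_right]
  by (auto simp: bounded_operators_def linear_def)

definition attains_norm_at ::
    "('x::real_normed_vector \<Rightarrow>\<^sub>L 'y::real_normed_vector) \<Rightarrow> 'x \<Rightarrow> bool"
  where "attains_norm_at T x \<longleftrightarrow> norm x = 1 \<and> norm (blinfun_apply T x) = norm T"

definition contraction ::
    "('k::real_or_complex \<Rightarrow> 'x::real_normed_vector \<Rightarrow> 'x) \<Rightarrow> ('k \<Rightarrow> 'y::real_normed_vector \<Rightarrow> 'y) \<Rightarrow>
      ('x \<Rightarrow>\<^sub>L 'y) \<Rightarrow> bool"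
  where "contraction sX sY T \<longleftrightarrow> T \<in> bounded_operators sX sY \<and> norm T \<le> 1"

definition extreme_contraction ::
    "('k::real_or_complex \<Rightarrow> 'x::real_normed_vector \<Rightarrow> 'x) \<Rightarrow> ('k \<Rightarrow> 'y::real_normed_vector \<Rightarrow> 'y) \<Rightarrow>
      ('x \<Rightarrow>\<^sub>L 'y) \<Rightarrow> bool"
  where "extreme_contraction sX sY T \<longleftrightarrow>
    contraction sX sY T \<and> T extreme_point_of (bounded_operators sX sY \<inter> cball 0 1)"

definition strictly_convex_space :: "'y::real_normed_vector itself \<Rightarrow> bool"
  where "strictly_convex_space _ \<longleftrightarrow>
    (\<forall>x y :: 'y. x \<noteq> 0 \<longrightarrow> norm (x + y) = norm x + norm y \<longrightarrow> (\<exists>k\<ge>0. y = k *\<^sub>R x))"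

end

theory Submission
  imports Defs
begin

text \<open>
  If \<open>T\<close> lies strictly between two contractions, then so does each \<open>T x\<^sub>i\<close> between their values at
  \<open>x\<^sub>i\<close>; as \<open>T x\<^sub>i\<close> has norm one, strict convexity makes these values equal, and the
  \<open>x\<^sub>i\<close> form a basis.
\<close>

text \<open>Norm one forces equality in the triangle inequality, so strict convexity puts both
  summands on one ray; as \<open>a\<close> and \<open>b\<close> then have equal norms, they
  coincide.\<close>

lemma strictly_convex_space_combination_eq:
  fixes a b :: "'y::real_normed_vector"
  assumes "strictly_convex_space TYPE('y)"
    and "norm a \<le> 1" and "norm b \<le> 1" and u: "0 < u" "u < 1"
    and one: "norm ((1 - u) *\<^sub>R a + u *\<^sub>R b) = 1"
  shows "a = b"
proof -
  have triangle: "1 \<le> (1 - u) * norm a + u * norm b"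
    using norm_triangle_ineq[of "(1 - u) *\<^sub>R a" "u *\<^sub>R b"] one u by simp
  have le: "(1 - u) * norm a \<le> 1 - u" "u * norm b \<le> u"
    using assms(2,3) u by (simp_all add: mult_left_le)
  \<comment> \<open>The two upper bounds add up to 1, the lower bound in \<open>triangle\<close>, so
    neither has slack.\<close>
  have "(1 - u) * norm a = 1 - u" "u * norm b = u"
    using triangle le by linarith+
  then have norms: "norm a = 1" "norm b = 1"
    using u by simp_all
  have "(1 - u) *\<^sub>R a \<noteq> 0"
    using norms u by auto
  moreover have "norm ((1 - u) *\<^sub>R a + u *\<^sub>R b) = norm ((1 - u) *\<^sub>R a) + norm (u *\<^sub>R b)"
    using one norms u by simp
  ultimately obtain k where k: "k \<ge> 0" "u *\<^sub>R b = k *\<^sub>R ((1 - u) *\<^sub>R a)"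
    using assms(1) unfolding strictly_convex_space_def by blast
  \<comment> \<open>Comparing norms fixes the ray factor; \<open>k \<ge> 0\<close> removes the
    absolute value.\<close>
  from k(2) have "norm (u *\<^sub>R b) = norm (k *\<^sub>R ((1 - u) *\<^sub>R a))"
    by simp
  then have "u = k * (1 - u)"
    using k(1) norms u by simp
  then have "u *\<^sub>R b = u *\<^sub>R a"
    using k(2) by simp
  then show ?thesis
    using u by simp
qed

text \<open>The dimension is \<open>card Basis\<close>, and an independent set of that size leaves
  no room for a vector outside its span.\<close>

lemma (in finite_dimensional_vector_space) independent_card_Basis_spans:
  assumes "independent S" and "card S = card Basis"
  shows "span S = UNIV"
  using card_ge_dim_independent[of S UNIV] assms by (auto simp: dim_UNIV)

theorem proposition2p4:
  fixes scaleX :: "'k::real_or_complex \<Rightarrow> 'x::banach \<Rightarrow> 'x"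
    and scaleY :: "'k \<Rightarrow> 'y::banach \<Rightarrow> 'y"
    and B :: "'x set"
    and n :: nat
    and T :: "'x \<Rightarrow>\<^sub>L 'y"
    and x :: "nat \<Rightarrow> 'x"
  assumes "normed_space_over scaleX"
    and "normed_space_over scaleY"
    and "finite_dimensional_vector_space scaleX B" and "card B = n"
    and "strictly_convex_space TYPE('y)"
    and "T \<in> bounded_operators scaleX scaleY"
    and "norm T = 1"
    and "inj_on x {1..n}" and "\<not> module.dependent scaleX (x ` {1..n})"
    and "\<And>i. i \<in> {1..n} \<Longrightarrow> attains_norm_at T (x i)"
  shows "extreme_contraction scaleX scaleY T"
proof -
  interpret X: finite_dimensional_vector_space scaleX B
    by fact
  interpret Y: normed_space_over scaleY
    by fact
  interpret XY: vector_space_pair scaleX scaleY ..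
  \<comment> \<open>Injectivity of \<open>x\<close> ensures that the image really has
    \<open>n = card B\<close> elements.\<close>
  have span: "X.span (x ` {1..n}) = UNIV"
    using assms(4,8,9) by (intro X.independent_card_Basis_spans) (simp_all add: card_image)
  have "A = C"
    if AC: "A \<in> bounded_operators scaleX scaleY" "C \<in> bounded_operators scaleX scaleY"
      "norm A \<le> 1" "norm C \<le> 1"
      and u: "0 < u" "u < 1" and T: "T = (1 - u) *\<^sub>R A + u *\<^sub>R C" for A C u
  proof (rule blinfun_eqI)
    have eq: "blinfun_apply A (x i) = blinfun_apply C (x i)" if i: "i \<in> {1..n}" for i
    proof (rule strictly_convex_space_combination_eq[OF assms(5) _ _ u])
      have x: "norm (x i) = 1" "norm (blinfun_apply T (x i)) = 1"
        using assms(10)[OF i] assms(7) by (simp_all add: attains_norm_at_def)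
      show "norm (blinfun_apply A (x i)) \<le> 1" "norm (blinfun_apply C (x i)) \<le> 1"
        using norm_blinfun[of A "x i"] norm_blinfun[of C "x i"] x AC(3,4) by simp_all
      show "norm ((1 - u) *\<^sub>R blinfun_apply A (x i) + u *\<^sub>R blinfun_apply C (x i)) = 1"
        using x(2) by (simp add: T blinfun.bilinear_simps)
    qed
    \<comment> \<open>The span is taken over \<open>'k\<close>, so this uses the
      \<open>'k\<close>-linearity recorded in \<open>bounded_operators\<close>, not just real
      linearity.\<close>
    show "blinfun_apply A v = blinfun_apply C v" for v
      by (rule XY.linear_eq_on_span[where B = "x ` {1..n}"])
        (use AC(1,2) eq span in \<open>auto simp: bounded_operators_def\<close>)
  qed
  \<comment> \<open>An open segment has distinct endpoints by definition, so \<open>A = C\<close>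
    excludes membership.\<close>
  then have "T \<notin> open_segment A C"
    if "A \<in> bounded_operators scaleX scaleY \<inter> cball 0 1"
      "C \<in> bounded_operators scaleX scaleY \<inter> cball 0 1" for A C
    using that by (auto simp: in_segment)
  then show ?thesis
    using assms(6,7) by (simp add: extreme_contraction_def contraction_def extreme_point_of_def)
qed

end
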